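(* Let $0<q<p<1$ and let $f,g$ be functions with domain $[0,\infty)$. If $f$ and $g$ are continuous at $x=0$ and $x=1$, then for $0\le a<b\le\infty$ the following formulas of $pq$-integration by parts hold: $$\int_{a}^{b}f(x^{q})\,d_{pq}g(x)=f(b)g(b)-f(a)g(a)-\int_{a}^{b}g(x^{p})\,d_{pq}f(x),$$ $$\int_{a}^{b}f(x^{p})\,d_{pq}g(x)=f(b)g(b)-f(a)g(a)-\int_{a}^{b}g(x^{q})\,d_{pq}f(x).$$ For $b=\infty$, $f(b)g(b)$ means $\lim_{x\to\infty}f(x)g(x)$, assumed to exist.
   Context: The $pq$-derivative is $D_{pq}h(x)=\dfrac{h(x^{p})-h(x^{q})}{x^{p}-x^{q}}$ for $x\ne0,1$, with $D_{pq}h(0)=\lim_{x\to0^{+}}D_{pq}h(x)$ and $D_{pq}h(1)=\lim_{x\to1}D_{pq}h(x)$. The notation $\int_a^b u(x)\,d_{pq}g(x)$ means $\int_a^b u(x)D_{pq}g(x)\,d_{pq}x$. The $pq$-integrals of a function $h$ are defined as follows (infinite sums are limits of partial sums). (1) For $c>1$: $\int_{1}^{c}h(x)\,d_{pq}x=\sum_{j=0}^{\infty}\left(c^{q^{j}p^{-j}}-c^{q^{j+1}p^{-j-1}}\right)h\left(c^{q^{j}p^{-j-1}}\right)$; for $1<a<b<\infty$: $\int_a^b h(x)\,d_{pq}x=\int_1^b h(x)\,d_{pq}x-\int_1^a h(x)\,d_{pq}x$. (2) For $0<c<1$: $\int_{c}^{1}h(x)\,d_{pq}x=\sum_{j=0}^{\infty}\left(c^{q^{j+1}p^{-j-1}}-c^{q^{j}p^{-j}}\right)h\left(c^{q^{j}p^{-j-1}}\right)$.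 (3) For $0<c<1$: $\int_{0}^{c}h(x)\,d_{pq}x=\sum_{j=0}^{\infty}\left(c^{q^{-j}p^{j}}-c^{q^{-j-1}p^{j+1}}\right)h\left(c^{q^{-j}p^{j+1}}\right)$; for $0<a<b<1$: $\int_a^b h(x)\,d_{pq}x=\int_0^b h(x)\,d_{pq}x-\int_0^a h(x)\,d_{pq}x$. (4) $\int_0^1 h(x)\,d_{pq}x=\sum_{j=-\infty}^{\infty}\left(p^{q^{j+1}p^{-j-1}}-p^{q^{j}p^{-j}}\right)h\left(p^{q^{-j}p^{j+1}}\right)$, where the base of the powers is the number $p$. (5) For $0\le a<1<b<\infty$: $\int_a^b h(x)\,d_{pq}x=\int_a^1 h(x)\,d_{pq}x+\int_1^b h(x)\,d_{pq}x$. (6) With $\beta=(q/p)^{-1}$: $\int_1^{\infty}h(x)\,d_{pq}x=\sum_{j=-\infty}^{\infty}\int_{\beta^{q^{j+1}p^{-j-1}}}^{\beta^{q^{j}p^{-j}}}h(x)\,d_{pq}x=\sum_{j=-\infty}^{\infty}\left(\beta^{q^{j}p^{-j}}-\beta^{q^{j+1}p^{-j-1}}\right)h\left(\beta^{q^{j}p^{-j-1}}\right)$. (7) For $0\le a<1$: $\int_a^\infty h(x)\,d_{pq}x=\int_a^1 h(x)\,d_{pq}x+\int_1^\infty h(x)\,d_{pq}x$. For $a>1$: $\int_a^\infty h(x)\,d_{pq}x=\lim_{N\to\infty}\sum_{j=1}^{N}\int_{a^{q^{-j+1}p^{j-1}}}^{a^{q^{-j}p^{j}}}h(x)\,d_{pq}x$.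 Exponents are real powers, e.g. $c^{q^{j}p^{-j}}$ is $c$ raised to the power $q^{j}p^{-j}$.
   Formalization: The sample points in the pq-integrals (3) and (4) are corrected to c^{q^{-j-1}p^j} and p^{q^j p^{-j-1}} (as printed the formulas fail for f=1, g=x^2); since integrals may diverge, each formula is stated as: one integral exists iff the other does, and then equality holds. *)

theory Defs
  imports "HOL-Analysis.Analysis"
begin

definition pq_deriv :: "real \<Rightarrow> real \<Rightarrow> (real \<Rightarrow> real) \<Rightarrow> real \<Rightarrow> real" where
  "pq_deriv p q h x =
     (let D = (\<lambda>x. (h (x powr p) - h (x powr q)) / (x powr p - x powr q)) in
      if x = 0 then Lim (at_right 0) D
      else if x = 1 then Lim (at 1) D
      else D x)"

text \<open>A doubly infinite series converges if its partial sums from \<open>-m\<close> to \<open>n\<close> converge as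
  \<open>m\<close> and \<open>n\<close> tend to infinity independently.\<close>

definition bi_sums :: "(int \<Rightarrow> real) \<Rightarrow> real \<Rightarrow> bool" where
  "bi_sums u s \<longleftrightarrow>
     ((\<lambda>(m, n). \<Sum>j = - int m..int n. u j) \<longlongrightarrow> s) (sequentially \<times>\<^sub>F sequentially)"

text \<open>\<open>has_pq_integral p q h a b I\<close>: every limit occurring in the definition of the integral of
  \<open>h\<close> from \<open>a\<close> to \<open>b\<close> exists, and the resulting value is \<open>I\<close>. The rules have mutually exclusive
  ranges of \<open>(a, b)\<close>, which together cover \<open>0 \<le> a < b \<le> \<infinity>\<close>.

  In every series the term belonging to the sample point \<open>x\<close> has the weight
  \<open>\<bar>x powr p - x powr q\<bar>\<close>; for example, in \<open>from_0\<close> the point \<open>x = c powr (p^j / q^(j+1))\<close> satisfies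
  \<open>x powr q = c powr (p^j / q^j)\<close> and \<open>x powr p = c powr (p^(j+1) / q^(j+1))\<close>. In the source, the
  sample points of \<open>from_0\<close> and \<open>from_0_to_1\<close> are printed as \<open>c powr (p^(j+1) / q^j)\<close> and
  \<open>p powr (q powi (-j) * p powi (j+1))\<close>, which is a misprint: these points do not match the weights,
  and the integral of the pq-derivative of \<open>h\<close> would then not be \<open>h b - h a\<close>, already for
  \<open>h x = x^2\<close>.\<close>

inductive has_pq_integral ::
    "real \<Rightarrow> real \<Rightarrow> (real \<Rightarrow> real) \<Rightarrow> real \<Rightarrow> ereal \<Rightarrow> real \<Rightarrow> bool"
  for p q :: real and h :: "real \<Rightarrow> real"
where
  from_1:
    "\<lbrakk>1 < c;
      (\<lambda>j. (c powr (q ^ j / p ^ j) - c powr (q ^ (j + 1) / p ^ (j + 1)))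
            * h (c powr (q ^ j / p ^ (j + 1)))) sums I\<rbrakk>
     \<Longrightarrow> has_pq_integral p q h 1 (ereal c) I"
| above_1:
    "\<lbrakk>1 < a; a < b; has_pq_integral p q h 1 (ereal b) I; has_pq_integral p q h 1 (ereal a) J\<rbrakk>
     \<Longrightarrow> has_pq_integral p q h a (ereal b) (I - J)"
| to_1:
    "\<lbrakk>0 < c; c < 1;
      (\<lambda>j. (c powr (q ^ (j + 1) / p ^ (j + 1)) - c powr (q ^ j / p ^ j))
            * h (c powr (q ^ j / p ^ (j + 1)))) sums I\<rbrakk>
     \<Longrightarrow> has_pq_integral p q h c 1 I"
| from_0:
    "\<lbrakk>0 < c; c < 1;
      (\<lambda>j. (c powr (p ^ j / q ^ j) - c powr (p ^ (j + 1) / q ^ (j + 1)))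
            * h (c powr (p ^ j / q ^ (j + 1)))) sums I\<rbrakk>
     \<Longrightarrow> has_pq_integral p q h 0 (ereal c) I"
| below_1:
    "\<lbrakk>0 < a; a < b; b < 1;
      has_pq_integral p q h 0 (ereal b) I; has_pq_integral p q h 0 (ereal a) J\<rbrakk>
     \<Longrightarrow> has_pq_integral p q h a (ereal b) (I - J)"
| from_0_to_1:
    "bi_sums (\<lambda>j. (p powr (q powi (j + 1) * p powi (- j - 1)) - p powr (q powi j * p powi (- j)))
            * h (p powr (q powi j * p powi (- j - 1)))) I
     \<Longrightarrow> has_pq_integral p q h 0 1 I"
| across_1:
    "\<lbrakk>0 \<le> a; a < 1; 1 < b; has_pq_integral p q h a 1 I; has_pq_integral p q h 1 b J\<rbrakk>
     \<Longrightarrow> has_pq_integral p q h a b (I + J)"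
| from_1_to_inf:
    "\<lbrakk>\<beta> = inverse (q / p);
      bi_sums (\<lambda>j. (\<beta> powr (q powi j * p powi (- j)) - \<beta> powr (q powi (j + 1) * p powi (- j - 1)))
            * h (\<beta> powr (q powi j * p powi (- j - 1)))) I\<rbrakk>
     \<Longrightarrow> has_pq_integral p q h 1 \<infinity> I"
| above_1_to_inf:
    "\<lbrakk>1 < a;
      \<And>j. has_pq_integral p q h (a powr (p ^ j / q ^ j))
             (ereal (a powr (p ^ (j + 1) / q ^ (j + 1)))) (I j);
      I sums S\<rbrakk>
     \<Longrightarrow> has_pq_integral p q h a \<infinity> S"

lemma bi_sums_unique: "bi_sums u s \<Longrightarrow> bi_sums u t \<Longrightarrow> s = t"
  unfolding bi_sums_def by (rule tendsto_unique[rotated]) (auto simp: prod_filter_eq_bot)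

lemma has_pq_integral_unique:
  "has_pq_integral p q h a b I \<Longrightarrow> has_pq_integral p q h a b K \<Longrightarrow> I = K"
proof (induction arbitrary: K rule: has_pq_integral.induct)
  case from_1
  from from_1.prems show ?case
    by (cases rule: has_pq_integral.cases) (use from_1.hyps in \<open>auto simp: one_ereal_def dest: sums_unique2\<close>)
next
  case (above_1 a b I J)
  from above_1.prems above_1.hyps(1-2) obtain I' J' where
    "has_pq_integral p q h 1 (ereal b) I'" "has_pq_integral p q h 1 (ereal a) J'" "K = I' - J'"
    by (cases rule: has_pq_integral.cases) (auto simp: one_ereal_def)
  with above_1.IH show ?case by blast
next
  case to_1
  from to_1.prems show ?case
    by (cases rule: has_pq_integral.cases) (use to_1.hyps in \<open>auto simp: one_ereal_def dest: sums_unique2\<close>)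
next
  case from_0
  from from_0.prems show ?case
    by (cases rule: has_pq_integral.cases) (use from_0.hyps in \<open>auto simp: one_ereal_def dest: sums_unique2\<close>)
next
  case (below_1 a b I J)
  from below_1.prems below_1.hyps(1-3) obtain I' J' where
    "has_pq_integral p q h 0 (ereal b) I'" "has_pq_integral p q h 0 (ereal a) J'" "K = I' - J'"
    by (cases rule: has_pq_integral.cases) (auto simp: one_ereal_def)
  with below_1.IH show ?case by blast
next
  case from_0_to_1
  from from_0_to_1.prems show ?case
    by (cases rule: has_pq_integral.cases) (use from_0_to_1.hyps in \<open>auto simp: one_ereal_def dest: bi_sums_unique\<close>)
next
  case (across_1 a b I J)
  from across_1.prems across_1.hyps(1-3) obtain I' J' where
    "has_pq_integral p q h a 1 I'" "has_pq_integral p q h 1 b J'" "K = I' + J'"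
    by (cases rule: has_pq_integral.cases) (auto simp: one_ereal_def)
  with across_1.IH show ?case by blast
next
  case from_1_to_inf
  from from_1_to_inf.prems show ?case
    by (cases rule: has_pq_integral.cases) (use from_1_to_inf.hyps in \<open>auto simp: one_ereal_def dest: bi_sums_unique\<close>)
next
  case (above_1_to_inf a I S)
  from above_1_to_inf.prems above_1_to_inf.hyps(1) obtain I' where
    "\<And>j. has_pq_integral p q h (a powr (p ^ j / q ^ j))
            (ereal (a powr (p ^ (j + 1) / q ^ (j + 1)))) (I' j)"
    "I' sums K"
    by (cases rule: has_pq_integral.cases) auto
  moreover from this above_1_to_inf.IH have "I = I'" by blast
  ultimately show ?case using above_1_to_inf.hyps sums_unique2 by blast
qed

definition pq_integrable :: "real \<Rightarrow> real \<Rightarrow> (real \<Rightarrow> real) \<Rightarrow> real \<Rightarrow> ereal \<Rightarrow> bool" where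
  "pq_integrable p q h a b \<longleftrightarrow> (\<exists>I. has_pq_integral p q h a b I)"

definition pq_integral :: "real \<Rightarrow> real \<Rightarrow> (real \<Rightarrow> real) \<Rightarrow> real \<Rightarrow> ereal \<Rightarrow> real" where
  "pq_integral p q h a b = (THE I. has_pq_integral p q h a b I)"

text \<open>The integral of \<open>u\<close> with respect to \<open>d\<^sub>p\<^sub>q g\<close>.\<close>

definition pq_stieltjes_integrable ::
    "real \<Rightarrow> real \<Rightarrow> (real \<Rightarrow> real) \<Rightarrow> (real \<Rightarrow> real) \<Rightarrow> real \<Rightarrow> ereal \<Rightarrow> bool" where
  "pq_stieltjes_integrable p q u g a b \<longleftrightarrow> pq_integrable p q (\<lambda>x. u x * pq_deriv p q g x) a b"

definition pq_stieltjes ::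
    "real \<Rightarrow> real \<Rightarrow> (real \<Rightarrow> real) \<Rightarrow> (real \<Rightarrow> real) \<Rightarrow> real \<Rightarrow> ereal \<Rightarrow> real" where
  "pq_stieltjes p q u g a b = pq_integral p q (\<lambda>x. u x * pq_deriv p q g x) a b"

definition value_at :: "(real \<Rightarrow> real) \<Rightarrow> ereal \<Rightarrow> real" where
  "value_at F b = (if b = \<infinity> then Lim at_top F else F (real_of_ereal b))"

end

theory Submission
  imports Defs
begin

text \<open>
  At every \<open>x > 0\<close> with \<open>x \<noteq> 1\<close>, the integrands \<open>f (x powr q) * pq_deriv p q g x\<close> and
  \<open>g (x powr p) * pq_deriv p q f x\<close> add up to the pq-derivative of \<open>F = f g\<close>. In each of the series
  defining the integral, the terms of this derivative telescope, because the points
  \<open>x powr p\<close> and \<open>x powr q\<close> belonging to one sample point \<open>x\<close> are consecutive points of a sequence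
  \<open>c powr r ^ j\<close>, and continuity at 0 and 1 gives the limits at the ends. So each series for one
  integrand converges if and only if the series for the other one does.
\<close>

section \<open>Limits of the nodes of the series\<close>

lemma powr_power_tendsto_1:
  fixes c r :: real
  assumes "0 < c" "0 \<le> r" "r < 1"
  shows "(\<lambda>n. c powr (r ^ n)) \<longlonglongrightarrow> 1"
proof -
  have "(\<lambda>n. c powr (r ^ n)) \<longlonglongrightarrow> c powr 0"
    using assms by (intro tendsto_intros LIMSEQ_realpow_zero) auto
  then show ?thesis using assms by simp
qed

lemma power_at_top:
  fixes s :: real
  assumes "1 < s"
  shows "filterlim (\<lambda>n. s ^ n) at_top sequentially"
  using assms
  by (intro filterlim_at_infinity_imp_filterlim_at_top filterlim_realpow_sequentially_gt1) auto

lemma powr_power_tendsto_0: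
  fixes c s :: real
  assumes "0 < c" "c < 1" "1 < s"
  shows "(\<lambda>n. c powr (s ^ n)) \<longlonglongrightarrow> 0"
proof -
  have "filterlim (\<lambda>n. ln c * s ^ n) at_bot sequentially"
    using assms
    by (intro filterlim_tendsto_neg_mult_at_bot[OF tendsto_const]
        power_at_top) auto
  then have "(\<lambda>n. exp (ln c * s ^ n)) \<longlonglongrightarrow> 0"
    by (rule filterlim_compose[OF exp_at_bot])
  then show ?thesis using assms by (simp add: powr_def mult.commute)
qed

lemma powr_power_at_top:
  fixes c s :: real
  assumes "1 < c" "1 < s"
  shows "filterlim (\<lambda>n. c powr (s ^ n)) at_top sequentially"
proof -
  have "filterlim (\<lambda>n. ln c * s ^ n) at_top sequentially"
    using assms
    by (intro filterlim_tendsto_pos_mult_at_top[OF tendsto_const]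
        power_at_top) auto
  then have "filterlim (\<lambda>n. exp (ln c * s ^ n)) at_top sequentially"
    by (rule filterlim_compose[OF exp_at_top])
  then show ?thesis using assms by (simp add: powr_def mult.commute)
qed

section \<open>Doubly infinite series\<close>

lemma bi_sums_telescope:
  fixes G :: "int \<Rightarrow> real"
  assumes "(\<lambda>n. G (int n)) \<longlonglongrightarrow> s" "(\<lambda>m. G (- int m)) \<longlonglongrightarrow> t"
  shows "bi_sums (\<lambda>j. G (j + 1) - G j) (s - t)"
proof -
  have tel: "(\<Sum>j = - int m..int n. G (j + 1) - G j) = G (int (Suc n)) - G (- int m)" for m n
  proof (induction n)
    case 0
    show ?case
    proof (induction m)
      case (Suc m)
      have "{- int (Suc m)..int 0} = insert (- int (Suc m)) {- int m..int 0}" by auto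
      with Suc show ?case by (simp add: algebra_simps)
    qed simp
  next
    case (Suc n)
    have "{- int m..int (Suc n)} = insert (int (Suc n)) {- int m..int n}" by auto
    with Suc show ?case by (simp add: algebra_simps)
  qed
  \<comment> \<open>One end of the telescoped sum depends on \<open>n\<close> alone and the other on
    \<open>m\<close> alone, so two one-variable limits give the limit along the product
    filter.\<close>
  have "((\<lambda>x. G (int (Suc (snd x))) - G (- int (fst x))) \<longlongrightarrow> s - t)
          (sequentially \<times>\<^sub>F sequentially)"
    by (intro tendsto_diff filterlim_compose[OF LIMSEQ_Suc[OF assms(1)] filterlim_snd]
        filterlim_compose[OF assms(2) filterlim_fst])
  then show ?thesis
    unfolding bi_sums_def tel by (simp add: case_prod_unfold)
qed

lemma bi_sums_diff:
  assumes "bi_sums u s" "bi_sums v t"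
  shows "bi_sums (\<lambda>j. u j - v j) (s - t)"
  using tendsto_diff[OF assms[unfolded bi_sums_def]]
  by (simp add: bi_sums_def case_prod_unfold sum_subtractf)

section \<open>From one integrand to the other\<close>

lemma value_at_ereal [simp]: "value_at F (ereal b) = F b" "value_at F 1 = F 1"
  by (simp_all add: value_at_def)

lemma value_at_inftyI: "(F \<longlongrightarrow> L) at_top \<Longrightarrow> value_at F \<infinity> = L"
  unfolding value_at_def by (simp add: tendsto_Lim)

text \<open>In each rule, subtracting the given series for \<open>u\<close> from the telescoping
  series for \<open>F\<close> leaves the series for \<open>v\<close>. Since \<open>u\<close> and
  \<open>v\<close> enter symmetrically, the result can be used in both directions. The sample points
  are never 0 or 1, so \<open>sum\<close> covers all of them.\<close>

lemma has_pq_integral_complement: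
  fixes p q a :: real and F u v :: "real \<Rightarrow> real"
  assumes pq: "0 < q" "q < p" and p1: "p < 1"
    and cont: "continuous (at 0 within {0..}) F" "continuous (at 1 within {0..}) F"
    and sum: "\<And>x. 0 < x \<Longrightarrow> x \<noteq> 1 \<Longrightarrow>
      (x powr p - x powr q) * (u x + v x) = F (x powr p) - F (x powr q)"
    and int: "has_pq_integral p q u a b I"
    and top: "b = \<infinity> \<Longrightarrow> \<exists>L. (F \<longlongrightarrow> L) at_top"
  shows "has_pq_integral p q v a b (value_at F b - F a - I)"
proof -
  \<comment> \<open>Here \<open>c powr e\<close> is the sample point \<open>x\<close>; then
    \<open>c powr y\<close> is \<open>x powr p\<close> and \<open>c powr z\<close> is
    \<open>x powr q\<close>. From \<open>c \<noteq> 1\<close> and \<open>e \<noteq> 0\<close> it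
    follows that \<open>x \<noteq> 1\<close>. The variant \<open>up\<close> serves the rules whose
    weight is \<open>x powr q - x powr p\<close>.\<close>
  have down: "(c powr y - c powr z) * v (c powr e)
      = F (c powr y) - F (c powr z) - (c powr y - c powr z) * u (c powr e)"
    if "0 < c" "c \<noteq> 1" "e \<noteq> 0" "y = e * p" "z = e * q" for c y z e
    using sum[of "c powr e"] that by (simp add: powr_powr algebra_simps)
  have up: "(c powr z - c powr y) * v (c powr e)
      = F (c powr z) - F (c powr y) - (c powr z - c powr y) * u (c powr e)"
    if "0 < c" "c \<noteq> 1" "e \<noteq> 0" "y = e * p" "z = e * q" for c y z e
    using down[OF that] by (simp add: algebra_simps)
  have to1: "(\<lambda>n. F (c powr (q ^ n / p ^ n))) \<longlonglongrightarrow> F 1" if "0 < c" for c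
    using continuous_within_tendsto_compose'[OF cont(2) _ powr_power_tendsto_1[of c "q / p"]]
      that pq by (simp add: power_divide)
  have to0: "(\<lambda>n. F (c powr (p ^ n / q ^ n))) \<longlonglongrightarrow> F 0" if "0 < c" "c < 1" for c
    using continuous_within_tendsto_compose'[OF cont(1) _ powr_power_tendsto_0[of c "p / q"]]
      that pq by (simp add: power_divide)
  have toinf: "(\<lambda>n. F (c powr (p ^ n / q ^ n))) \<longlonglongrightarrow> L" if "(F \<longlongrightarrow> L) at_top" "1 < c" for c L
    using filterlim_compose[OF that(1) powr_power_at_top[of c "p / q"]] that pq
    by (simp add: power_divide)
  \<comment> \<open>\<open>E j\<close> is \<open>(q / p) powi j\<close>: it tends to 0 as
    \<open>j\<close> grows and to infinity as \<open>j\<close> decreases. The sample exponent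
    \<open>q powi j * p powi (- j - 1)\<close> becomes \<open>E j\<close> when multiplied by
    \<open>p\<close>, and \<open>E (j + 1)\<close> when multiplied by \<open>q\<close>.\<close>
  define E where "E j = q powi j * p powi (- j)" for j
  have E_nat: "E (int n) = q ^ n / p ^ n" "E (- int n) = p ^ n / q ^ n" for n
    by (simp_all add: E_def power_int_minus divide_inverse)
  have E_powi: "E j = q powi j * p powi (- j - 1) * p"
      "q powi (j + 1) * p powi (- j - 1) = q powi j * p powi (- j - 1) * q"
      "E (j + 1) = q powi j * p powi (- j - 1) * q" for j
    using pq by (simp_all add: E_def power_int_add power_int_diff power_int_minus field_simps)
  show ?thesis
    \<comment> \<open>The premise \<open>top\<close> takes part in the induction because the upper
      end varies: it is vacuous for finite ends and is passed on in \<open>across_1\<close>.\<close>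
    using int top
  proof (induction rule: has_pq_integral.induct)
    case (from_1 c I)
    have "(\<lambda>j. F (c powr (q ^ j / p ^ j)) - F (c powr (q ^ Suc j / p ^ Suc j))) sums
        (F (c powr (q ^ 0 / p ^ 0)) - F 1)"
      by (rule telescope_sums'[OF to1]) (use from_1 in simp)
    from sums_diff[OF this from_1.hyps(2)]
    have "(\<lambda>j. (c powr (q ^ j / p ^ j) - c powr (q ^ (j + 1) / p ^ (j + 1)))
            * v (c powr (q ^ j / p ^ (j + 1)))) sums (F c - F 1 - I)"
      using from_1.hyps(1) pq by (subst down) auto
    with from_1.hyps(1) show ?case
      by (auto intro: has_pq_integral.from_1)
  next
    case (above_1 a b I J)
    \<comment> \<open>The boundary value \<open>F 1\<close> of the two integrals cancels.\<close>
    have "has_pq_integral p q v a (ereal b)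
       ((F b - F 1 - I) - (F a - F 1 - J))"
      using above_1 by - (rule has_pq_integral.above_1, auto)
    then show ?case by (simp add: algebra_simps)
  next
    case (to_1 c I)
    have "(\<lambda>j. F (c powr (q ^ Suc j / p ^ Suc j)) - F (c powr (q ^ j / p ^ j))) sums
        (F 1 - F (c powr (q ^ 0 / p ^ 0)))"
      by (rule telescope_sums[OF to1]) (use to_1 in simp)
    from sums_diff[OF this to_1.hyps(3)]
    have "(\<lambda>j. (c powr (q ^ (j + 1) / p ^ (j + 1)) - c powr (q ^ j / p ^ j))
            * v (c powr (q ^ j / p ^ (j + 1)))) sums (F 1 - F c - I)"
      using to_1.hyps(1,2) pq by (subst up) auto
    with to_1.hyps(1,2) show ?case
      by (auto intro: has_pq_integral.to_1)
  next
    case (from_0 c I)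
    have "(\<lambda>j. F (c powr (p ^ j / q ^ j)) - F (c powr (p ^ Suc j / q ^ Suc j))) sums
        (F (c powr (p ^ 0 / q ^ 0)) - F 0)"
      by (rule telescope_sums'[OF to0]) (use from_0 in simp_all)
    from sums_diff[OF this from_0.hyps(3)]
    have "(\<lambda>j. (c powr (p ^ j / q ^ j) - c powr (p ^ (j + 1) / q ^ (j + 1)))
            * v (c powr (p ^ j / q ^ (j + 1)))) sums (F c - F 0 - I)"
      using from_0.hyps(1,2) pq by (subst up) auto
    with from_0.hyps(1,2) show ?case
      by (auto intro: has_pq_integral.from_0)
  next
    case (below_1 a b I J)
    have "has_pq_integral p q v a (ereal b)
       ((F b - F 0 - I) - (F a - F 0 - J))"
      using below_1 by - (rule has_pq_integral.below_1, auto)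
    then show ?case by (simp add: algebra_simps)
  next
    case (from_0_to_1 I)
    have "bi_sums (\<lambda>j. F (p powr E (j + 1)) - F (p powr E j)) (F 1 - F 0)"
      using to1[of p] to0[of p] pq p1 by (intro bi_sums_telescope) (simp_all add: E_nat)
    from bi_sums_diff[OF this[unfolded E_powi(3)] from_0_to_1.hyps]
    have "bi_sums (\<lambda>j. (p powr (q powi (j + 1) * p powi (- j - 1))
              - p powr (q powi j * p powi (- j)))
            * v (p powr (q powi j * p powi (- j - 1)))) (F 1 - F 0 - I)"
      using pq p1 by (subst up) (auto simp: E_powi simp flip: E_def)
    then show ?case
      by (auto intro: has_pq_integral.from_0_to_1)
  next
    case (across_1 a b I J)
    have "has_pq_integral p q v a b
       ((value_at F 1 - F a - I) + (value_at F b - F 1 - J))"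
      using across_1 by - (rule has_pq_integral.across_1, auto)
    then show ?case by (simp add: algebra_simps)
  next
    case (from_1_to_inf \<beta> I)
    then obtain L where L: "(F \<longlongrightarrow> L) at_top" by blast
    have \<beta>: "1 < \<beta>" using from_1_to_inf.hyps(1) pq by simp
    \<comment> \<open>The nodes descend from infinity to 1 as \<open>j\<close> increases, so
      \<open>- F\<close> has the increments that match the positive weights.\<close>
    have "bi_sums (\<lambda>j. - F (\<beta> powr E (j + 1)) - (- F (\<beta> powr E j))) (- F 1 - (- L))"
      using to1[of \<beta>] toinf[OF L \<beta>] \<beta>
      by (intro bi_sums_telescope tendsto_minus) (simp_all add: E_nat)
    from bi_sums_diff[OF this[unfolded E_powi(3)] from_1_to_inf.hyps(2)]
    have "bi_sums (\<lambda>j. (\<beta> powr (q powi j * p powi (- j))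
              - \<beta> powr (q powi (j + 1) * p powi (- j - 1)))
            * v (\<beta> powr (q powi j * p powi (- j - 1)))) (L - F 1 - I)"
      using pq \<beta> by (subst down) (auto simp: E_powi simp flip: E_def)
    with from_1_to_inf.hyps(1) value_at_inftyI[OF L] show ?case
      by (auto intro: has_pq_integral.from_1_to_inf)
  next
    case (above_1_to_inf a I S)
    then obtain L where L: "(F \<longlongrightarrow> L) at_top" by blast
    have "(\<lambda>j. F (a powr (p ^ Suc j / q ^ Suc j)) - F (a powr (p ^ j / q ^ j))) sums
        (L - F (a powr (p ^ 0 / q ^ 0)))"
      using toinf[OF L above_1_to_inf.hyps(1)] by (rule telescope_sums)
    from sums_diff[OF this above_1_to_inf.hyps(3)]
    \<comment> \<open>The summand is the integral of \<open>v\<close> over the \<open>j\<close>-th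
      piece in the form given by the induction hypothesis.\<close>
    have "(\<lambda>j. value_at F (ereal (a powr (p ^ (j + 1) / q ^ (j + 1))))
        - F (a powr (p ^ j / q ^ j)) - I j) sums (L - F a - S)"
      using above_1_to_inf.hyps(1) by simp
    with above_1_to_inf.hyps(1) above_1_to_inf.IH have "has_pq_integral p q v a \<infinity> (L - F a - S)"
      by - (rule has_pq_integral.above_1_to_inf, auto)
    with value_at_inftyI[OF L] show ?case by simp
  qed
qed

section \<open>Product rule and integration by parts\<close>

lemma pq_integral_eqI: "has_pq_integral p q h a b I \<Longrightarrow> pq_integral p q h a b = I"
  unfolding pq_integral_def using has_pq_integral_unique by blast

lemma pq_stieltjes_by_parts:
  fixes p q a :: real and f g :: "real \<Rightarrow> real"
  assumes pq: "0 < q" "q < p" "p < 1"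
    and f: "continuous (at 0 within {0..}) f" "continuous (at 1 within {0..}) f"
    and g: "continuous (at 0 within {0..}) g" "continuous (at 1 within {0..}) g"
    and top: "b = \<infinity> \<Longrightarrow> \<exists>L. ((\<lambda>x. f x * g x) \<longlongrightarrow> L) at_top"
  shows "pq_stieltjes_integrable p q (\<lambda>x. f (x powr q)) g a b \<longleftrightarrow>
          pq_stieltjes_integrable p q (\<lambda>x. g (x powr p)) f a b" (is ?int)
    and "pq_stieltjes_integrable p q (\<lambda>x. f (x powr q)) g a b \<Longrightarrow>
          pq_stieltjes p q (\<lambda>x. f (x powr q)) g a b =
            value_at (\<lambda>x. f x * g x) b - f a * g a - pq_stieltjes p q (\<lambda>x. g (x powr p)) f a b"
proof -
  let ?u = "\<lambda>x. f (x powr q) * pq_deriv p q g x"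
  let ?v = "\<lambda>x. g (x powr p) * pq_deriv p q f x"
  let ?F = "\<lambda>x. f x * g x"
  have cont: "continuous (at 0 within {0..}) ?F" "continuous (at 1 within {0..}) ?F"
    using f g by (auto intro: continuous_mult)
  \<comment> \<open>As \<open>p \<noteq> q\<close>, the denominator is nonzero at these points, and
    the limits defining the derivative at 0 and 1 do not enter.\<close>
  have deriv: "(x powr p - x powr q) * pq_deriv p q h x = h (x powr p) - h (x powr q)"
    if "0 < x" "x \<noteq> 1" for h x
    using that pq by (auto simp: pq_deriv_def powr_inj)
  have sum: "(x powr p - x powr q) * (?u x + ?v x) = ?F (x powr p) - ?F (x powr q)"
    if "0 < x" "x \<noteq> 1" for x
  proof -
    have "(x powr p - x powr q) * (?u x + ?v x)
        = f (x powr q) * ((x powr p - x powr q) * pq_deriv p q g x)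
          + g (x powr p) * ((x powr p - x powr q) * pq_deriv p q f x)"
      by (simp add: algebra_simps)
    \<comment> \<open>The cross term \<open>f (x powr q) * g (x powr p)\<close> cancels.\<close>
    also have "\<dots> = ?F (x powr p) - ?F (x powr q)"
      unfolding deriv[OF that] by (simp add: algebra_simps)
    finally show ?thesis .
  qed
  have uv: "has_pq_integral p q ?v a b (value_at ?F b - ?F a - I)"
    if "has_pq_integral p q ?u a b I" for I
    using pq(1-3) cont sum that top by (rule has_pq_integral_complement)
  have vu: "has_pq_integral p q ?u a b (value_at ?F b - ?F a - I)"
    if "has_pq_integral p q ?v a b I" for I
    using pq(1-3) cont sum[unfolded add.commute[of "?u _"]] that top
    by (rule has_pq_integral_complement)
  show ?int
    unfolding pq_stieltjes_integrable_def pq_integrable_def using uv vu by blast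
  assume "pq_stieltjes_integrable p q (\<lambda>x. f (x powr q)) g a b"
  then obtain I where "has_pq_integral p q ?u a b I"
    unfolding pq_stieltjes_integrable_def pq_integrable_def by blast
  with uv[OF this] show "pq_stieltjes p q (\<lambda>x. f (x powr q)) g a b =
            value_at ?F b - f a * g a - pq_stieltjes p q (\<lambda>x. g (x powr p)) f a b"
    by (simp add: pq_stieltjes_def pq_integral_eqI)
qed

theorem corollary6p2:
  fixes p q a :: real and b :: ereal and f g :: "real \<Rightarrow> real"
  assumes "0 < q" and "q < p" and "p < 1"
    and "continuous (at 0 within {0..}) f" and "continuous (at 1 within {0..}) f"
    and "continuous (at 0 within {0..}) g" and "continuous (at 1 within {0..}) g"
    and "0 \<le> a" and "ereal a < b"
    and "b = \<infinity> \<Longrightarrow> \<exists>L. ((\<lambda>x. f x * g x) \<longlongrightarrow> L) at_top"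
  shows "(pq_stieltjes_integrable p q (\<lambda>x. f (x powr q)) g a b \<longleftrightarrow>
            pq_stieltjes_integrable p q (\<lambda>x. g (x powr p)) f a b) \<and>
         (pq_stieltjes_integrable p q (\<lambda>x. f (x powr q)) g a b \<longrightarrow>
            pq_stieltjes p q (\<lambda>x. f (x powr q)) g a b =
              value_at (\<lambda>x. f x * g x) b - f a * g a
              - pq_stieltjes p q (\<lambda>x. g (x powr p)) f a b) \<and>
         (pq_stieltjes_integrable p q (\<lambda>x. f (x powr p)) g a b \<longleftrightarrow>
            pq_stieltjes_integrable p q (\<lambda>x. g (x powr q)) f a b) \<and>
         (pq_stieltjes_integrable p q (\<lambda>x. f (x powr p)) g a b \<longrightarrow>
            pq_stieltjes p q (\<lambda>x. f (x powr p)) g a b =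
              value_at (\<lambda>x. f x * g x) b - f a * g a
              - pq_stieltjes p q (\<lambda>x. g (x powr q)) f a b)"
proof -
  have swap: "(\<lambda>x. g x * f x) = (\<lambda>x. f x * g x)" "g a * f a = f a * g a"
    by (simp_all add: mult.commute)
  note 1 = pq_stieltjes_by_parts[where a = a and b = b, OF assms(1-7)]
  \<comment> \<open>Exchanging \<open>f\<close> and \<open>g\<close> yields the second formula,
    solved for its other integral; \<open>int2\<close> supplies the integrability needed to
    rearrange it.\<close>
  note 2 = pq_stieltjes_by_parts[where a = a and b = b, OF assms(1-3) assms(6,7,4,5),
      unfolded swap]
  have int1: "pq_stieltjes_integrable p q (\<lambda>x. f (x powr q)) g a b \<longleftrightarrow>
      pq_stieltjes_integrable p q (\<lambda>x. g (x powr p)) f a b"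
    using assms(10) by (rule 1)
  have int2: "pq_stieltjes_integrable p q (\<lambda>x. g (x powr q)) f a b \<longleftrightarrow>
      pq_stieltjes_integrable p q (\<lambda>x. f (x powr p)) g a b"
    using assms(10) by (rule 2)
  show ?thesis
    using int1 1(2)[OF assms(10)] int2 2(2)[OF assms(10)] by auto
qed

end
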